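(* Let $S=\operatorname{diag}(s_1,\dots,s_\nu)$ and $L=[1\ \cdots\ 1]\in\mathbb{R}^{1\times\nu}$. Then $\lambda_1,\dots,\lambda_\ell$ are poles of $K_G(s)=C\Pi(sI-S+GL)^{-1}G$ if and only if $G\in\mathbb{C}^{\nu}$ is a solution of the linear system $$1+LD_k^{-1}G=0,\qquad k=1,\dots,\ell,$$ where $D_k=\operatorname{diag}(\theta_{k1},\dots,\theta_{k\nu})$ with $\theta_{ki}=\lambda_k-s_i$ for $i=1,\dots,\nu$ and $k=1,\dots,\ell$.
   Context: $\sigma(M)$ denotes the spectrum of a matrix $M$. The single-input single-output system $\dot x=Ax+Bu,\ y=Cx$ has $A\in\mathbb{R}^{n\times n}$, $B\in\mathbb{R}^{n\times 1}$, $C\in\mathbb{R}^{1\times n}$, is controllable and observable, and is stable (all eigenvalues of $A$ have negative real part). $S\in\mathbb{C}^{\nu\times\nu}$ has spectrum closed under complex conjugation with $\sigma(S)\cap\sigma(A)=\emptyset$, and $(L,S)$ is observable (so for diagonal $S$ the $s_i$ are pairwise distinct). $\Pi\in\mathbb{C}^{n\times\nu}$ is the unique solution of $A\Pi+BL=\Pi S$. The family of $\nu$-order models $\Sigma_G:\ \dot\xi=(S-GL)\xi+Gu,\ \psi=C\Pi\xi$ has transfer function $K_G$, with $G\in\mathbb{C}^\nu$ such that $\sigma(S-GL)\cap\sigma(S)=\emptyset$. Let $\ell\le\nu$ and $\lambda_1,\dots,\lambda_\ell\in\mathbb{C}\setminus\sigma(S)$, with $\{\lambda_1,\dots,\lambda_\ell\}$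 closed under complex conjugation. Convention: $\lambda\in\mathbb{C}$ is called a pole of $\Sigma_G$ (or of $K_G$) if $\det(\lambda I-S+GL)=0$. *)

theory Defs
  imports "HOL-Analysis.Analysis"
begin

definition spectrum :: "complex^'n^'n \<Rightarrow> complex set" where
  "spectrum M = {z. \<exists>v. v \<noteq> 0 \<and> M *v v = z *s v}"

abbreviation complexify :: "real^'n^'m \<Rightarrow> complex^'n^'m" where
  "complexify \<equiv> map_matrix complex_of_real"

definition conj_closed :: "complex set \<Rightarrow> bool" where
  "conj_closed X \<longleftrightarrow> (\<forall>z\<in>X. cnj z \<in> X)"

definition diag_matrix :: "('n \<Rightarrow> 'a::zero) \<Rightarrow> 'a^'n^'n" where
  "diag_matrix d = (\<chi> i j. if i = j then d i else 0)"

(* Multiplication on vec is componentwise, so the power operation of the library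
   is not the matrix power. *)
primrec matrix_pow :: "'a::semiring_1^'n^'n \<Rightarrow> nat \<Rightarrow> 'a^'n^'n" where
  "matrix_pow M 0 = mat 1"
| "matrix_pow M (Suc k) = M ** matrix_pow M k"

(* Kalman rank conditions. The columns of [B, AB, ..., A^(n-1) B] are the columns of its
   blocks, so the dimension of their span is the rank of the controllability matrix;
   dually for the rows of the stacked observability matrix. *)
definition controllable :: "'a::field^'n^'n \<Rightarrow> 'a^'m^'n \<Rightarrow> bool" where
  "controllable A B \<longleftrightarrow>
     vec.dim (\<Union>k<CARD('n). columns (matrix_pow A k ** B)) = CARD('n)"

definition observable :: "'a::field^'n^'p \<Rightarrow> 'a^'n^'n \<Rightarrow> bool" where
  "observable C A \<longleftrightarrow>
     vec.dim (\<Union>k<CARD('n). rows (C ** matrix_pow A k)) = CARD('n)"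

definition stable_matrix :: "real^'n^'n \<Rightarrow> bool" where
  "stable_matrix A \<longleftrightarrow> (\<forall>z\<in>spectrum (complexify A). Re z < 0)"

definition solves_sylvester ::
  "real^'n^'n \<Rightarrow> real^1^'n \<Rightarrow> complex^'v^'v \<Rightarrow> complex^'v^1 \<Rightarrow> complex^'v^'n \<Rightarrow> bool" where
  "solves_sylvester A B S L P \<longleftrightarrow> complexify A ** P + complexify B ** L = P ** S"

(* A triple (F, G, H) stands for the system x' = F x + G u, y = H x. *)
type_synonym 'v model = "(complex^'v^'v) \<times> (complex^1^'v) \<times> (complex^'v^1)"

definition reduced_model ::
  "real^'n^1 \<Rightarrow> complex^'v^'n \<Rightarrow> complex^'v^'v \<Rightarrow> complex^'v^1 \<Rightarrow> complex^1^'v \<Rightarrow> 'v model" where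
  "reduced_model C P S L G = (S - G ** L, G, complexify C ** P)"

fun transfer_function :: "'v::finite model \<Rightarrow> complex \<Rightarrow> complex^1^1" where
  "transfer_function (F, G, H) z = H ** matrix_inv (mat z - F) ** G"

(* By convention a pole is a zero of the characteristic polynomial of the realization;
   a zero that cancels in the transfer function still counts. *)
fun pole :: "'v::finite model \<Rightarrow> complex \<Rightarrow> bool" where
  "pole (F, G, H) z \<longleftrightarrow> det (mat z - F) = 0"

lemma transfer_function_reduced_model:
  "transfer_function (reduced_model C P S L G) z =
     complexify C ** P ** matrix_inv (mat z - S + G ** L) ** G"
  by (simp add: reduced_model_def algebra_simps)

lemma pole_reduced_model:
  "pole (reduced_model C P S L G) z \<longleftrightarrow> det (mat z - S + G ** L) = 0"
  by (simp add: reduced_model_def algebra_simps)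

end

theory Submission
  imports Defs
begin

text \<open>
  A kernel vector \<open>v\<close> of \<open>D + G ** L\<close> satisfies \<open>v = - D\<inverse> G (L v)\<close>, so \<open>L\<close> maps the kernel of
  \<open>D + G ** L\<close> into that of \<open>I + L D\<inverse> G\<close>, and \<open>D\<inverse> G\<close> maps back; both maps are injective.
  Hence the two matrices are singular simultaneously. Apply this to
  \<open>D = \<lambda> I - S\<close>, for which \<open>I + L D\<inverse> G\<close> is a scalar.
\<close>

lemma det_eq_0_iff_kernel:
  fixes M :: "'a::field^'n^'n"
  shows "det M = 0 \<longleftrightarrow> (\<exists>v. v \<noteq> 0 \<and> M *v v = 0)"
  using invertible_det_nz[of M] matrix_left_invertible_ker[of M]
  by (auto simp: invertible_left_inverse)

lemma matrix_mul_matrix_inv: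
  fixes M :: "'a::field^'n^'n"
  assumes "invertible M"
  shows "M ** matrix_inv M = mat 1" and "matrix_inv M ** M = mat 1"
  using assms unfolding invertible_def matrix_inv_def by (metis (mono_tags, lifting) someI_ex)+

text \<open>The zero-set form of the matrix determinant lemma \<open>det (D + G ** L) = det D * det
  (mat 1 + L ** matrix_inv D ** G)\<close>. Comparing kernels avoids block determinants, although
  the two matrices have different sizes.\<close>

lemma det_add_matrix_mul_eq_0_iff:
  fixes D :: "'a::field^'n^'n" and G :: "'a^'m^'n" and L :: "'a^'n^'m"
  assumes "invertible D"
  shows "det (D + G ** L) = 0 \<longleftrightarrow> det (mat 1 + L ** matrix_inv D ** G) = 0"
proof -
  note inv = matrix_mul_matrix_inv[OF assms]
  have cancel: "matrix_inv D *v (D *v v) = v" "D *v (matrix_inv D *v v) = v" for v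
    by (simp_all add: matrix_vector_mul_assoc inv)
  have low: "(D + G ** L) *v v = D *v v + G *v (L *v v)" for v
    by (simp add: matrix_vector_mult_add_rdistrib matrix_vector_mul_assoc)
  have schur: "(mat 1 + L ** matrix_inv D ** G) *v w = w + L *v (matrix_inv D *v (G *v w))" for w
    by (simp add: matrix_vector_mult_add_rdistrib matrix_vector_mul_assoc matrix_mul_assoc)
  have neg: "M *v (- x) = - (M *v x)" for M :: "'a^'p^'q" and x
    using matrix_vector_mult_diff_distrib[of M 0 x] by simp
  show ?thesis
    unfolding det_eq_0_iff_kernel
  proof
    assume "\<exists>v. v \<noteq> 0 \<and> (D + G ** L) *v v = 0"
    then obtain v where v: "v \<noteq> 0" "D *v v + G *v (L *v v) = 0"
      unfolding low by blast
    have "G *v (L *v v) = - (D *v v)"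
      using v(2) by (simp add: eq_neg_iff_add_eq_0 add.commute)
    then have Dinv: "matrix_inv D *v (G *v (L *v v)) = - v"
      by (simp add: neg cancel)
    \<comment> \<open>If \<open>L *v v\<close> vanished, \<open>Dinv\<close> would force
      \<open>v = 0\<close>.\<close>
    then have "L *v v \<noteq> 0"
      using v(1) by auto
    then show "\<exists>w. w \<noteq> 0 \<and> (mat 1 + L ** matrix_inv D ** G) *v w = 0"
      unfolding schur by (intro exI[of _ "L *v v"]) (simp add: Dinv neg)
  next
    assume "\<exists>w. w \<noteq> 0 \<and> (mat 1 + L ** matrix_inv D ** G) *v w = 0"
    then obtain w where w: "w \<noteq> 0" "w + L *v (matrix_inv D *v (G *v w)) = 0"
      unfolding schur by blast
    \<comment> \<open>Any kernel vector with \<open>L *v v = - w\<close> must be this one, since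
      then \<open>D *v v = G *v w\<close>.\<close>
    define v where "v = matrix_inv D *v (G *v w)"
    have Lv: "L *v v = - w"
      using w(2) by (simp add: v_def eq_neg_iff_add_eq_0 add.commute)
    then have "v \<noteq> 0"
      using w(1) by auto
    moreover have "D *v v + G *v (L *v v) = 0"
      unfolding Lv by (simp add: v_def cancel neg)
    ultimately show "\<exists>v. v \<noteq> 0 \<and> (D + G ** L) *v v = 0"
      unfolding low by blast
  qed
qed

text \<open>Turns the hypothesis that \<open>lam k\<close> avoids \<open>spectrum S\<close>, which
  is phrased by eigenvectors, into invertibility of \<open>D k\<close>.\<close>

lemma invertible_mat_minus_iff_spectrum:
  "invertible (mat z - M) \<longleftrightarrow> z \<notin> spectrum M"
proof -
  have "mat z *v v = z *s v" for v :: "complex^'a"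
    by (simp add: vec_eq_iff matrix_vector_mult_def mat_def if_distrib[of "\<lambda>x. x * _"] cong: if_cong)
  then have "(mat z - M) *v v = 0 \<longleftrightarrow> M *v v = z *s v" for v
    by (auto simp: matrix_vector_mult_diff_rdistrib)
  then show ?thesis
    unfolding invertible_det_nz det_eq_0_iff_kernel spectrum_def by auto
qed

text \<open>The determinant of a 1x1 matrix is its only entry, so the scalar equation on
  \<open>G\<close> is a singularity condition.\<close>

lemma matrix_1x1_eq_0_iff_det:
  fixes M :: "'a::comm_ring_1^1^1"
  shows "M = 0 \<longleftrightarrow> det M = 0"
  by (simp add: vec_eq_iff det_1)

theorem proposition8:
  fixes A :: "real^'n^'n" and B :: "real^1^'n" and C :: "real^'n^1"
    and S :: "complex^'v^'v" and L :: "complex^'v^1" and P :: "complex^'v^'n"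
    and G :: "complex^1^'v"
    and s :: "'v \<Rightarrow> complex"
    and l :: nat and lam :: "nat \<Rightarrow> complex"
    and \<theta> :: "nat \<Rightarrow> 'v \<Rightarrow> complex" and D :: "nat \<Rightarrow> complex^'v^'v"
  assumes "controllable A B" and "observable C A" and "stable_matrix A"
    and "S = diag_matrix s" and "L = (\<chi> i j. 1)"
    and "conj_closed (spectrum S)"
    and "spectrum S \<inter> spectrum (complexify A) = {}"
    and "observable L S"
    and "solves_sylvester A B S L P"
    and "\<And>X. solves_sylvester A B S L X \<Longrightarrow> X = P"
    and "spectrum (S - G ** L) \<inter> spectrum S = {}"
    and "l \<le> CARD('v)"
    and "\<And>k. k \<in> {1..l} \<Longrightarrow> lam k \<notin> spectrum S"
    and "conj_closed (lam ` {1..l})"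
    and "\<And>k i. k \<in> {1..l} \<Longrightarrow> \<theta> k i = lam k - s i"
    and "\<And>k. k \<in> {1..l} \<Longrightarrow> D k = diag_matrix (\<theta> k)"
  shows "(\<forall>k\<in>{1..l}. pole (reduced_model C P S L G) (lam k)) \<longleftrightarrow>
         (\<forall>k\<in>{1..l}. mat 1 + L ** matrix_inv (D k) ** G = 0)"
\<comment> \<open>The equivalence holds for each \<open>k\<close> separately.\<close>
proof (rule ball_cong[OF refl])
  fix k assume k: "k \<in> {1..l}"
  have D: "D k = mat (lam k) - S"
    using assms(15,16)[OF k] \<open>S = diag_matrix s\<close>
    by (simp add: vec_eq_iff diag_matrix_def mat_def)
  then have "invertible (D k)"
    using assms(13)[OF k] by (simp add: invertible_mat_minus_iff_spectrum)
  then show "pole (reduced_model C P S L G) (lam k) \<longleftrightarrow> mat 1 + L ** matrix_inv (D k) ** G = 0"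
    \<comment> \<open>Folding \<open>D k\<close> back in gives the pole condition the shape
      \<open>det (D k + G ** L) = 0\<close>.\<close>
    unfolding pole_reduced_model D[symmetric]
    by (simp only: det_add_matrix_mul_eq_0_iff matrix_1x1_eq_0_iff_det)
qed

end
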